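(* Let $(C,\tau^C)$ be a (non-empty) compact Hausdorff space and $(\Theta,\tau^\Theta)$ a (non-empty) Hausdorff space. Let $U:\Theta\times C\to\mathbb{R}$ be jointly continuous and $V:\Theta\times C\to\mathbb{R}$ jointly upper semicontinuous. Assume that either (i) $\Theta$ is compact, or (ii) $V$ is bounded. Let $\underline{u}:\Theta\to\mathbb{R}$ be a function for which there exists $c^*\in C$ with $U(\theta,c^* )\ge\underline{u}(\theta)$ for all $\theta\in\Theta$. Let $\mathbb{K}$ be a non-empty set of regular Borel probability measures on $\Theta$ and $\alpha:\mathbb{K}\to\mathbb{R}$ a function. Then delegated contracting via menus and centralized contracting via mechanisms give the principal the same optimal utility level: $$\sup_{D\in T}\ \inf_{\kappa\in\mathbb{K}}\left\{\int_\Theta V^*(\theta,D)\,d\kappa(\theta)+\alpha(\kappa)\right\}=\sup_{\varphi\in\hat M}\ \inf_{\kappa\in\mathbb{K}}\left\{\int_\Theta V(\theta,\varphi(\theta))\,d\kappa(\theta)+\alpha(\kappa)\right\}.$$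
   Context: $\mathrm{CL}(C)$ denotes the family of all non-empty closed subsets of $C$ (menus). For $\theta\in\Theta$, $D\in\mathrm{CL}(C)$ put $$U^*(\theta,D):=\sup_{d\in D}U(\theta,d),\qquad \Phi(\theta,D):=\operatorname*{arg\,max}_{d\in D}U(\theta,d),\qquad V^*(\theta,D):=\sup_{d\in\Phi(\theta,D)}V(\theta,d),$$ and $T:=\{D\in\mathrm{CL}(C): U^*(\theta,D)\ge\underline{u}(\theta)\ \text{for all }\theta\in\Theta\}$ (individually rational menus). A contract mechanism is an arbitrary map $\varphi:\Theta\to C$. $M$ is the set of contract mechanisms that are individually rational ($U(\theta,\varphi(\theta))\ge\underline{u}(\theta)$ for all $\theta$) and incentive compatible ($U(\theta,\varphi(\theta))\ge U(\theta,\varphi(\theta'))$ for all $\theta,\theta'$), and $\hat M:=\{\varphi\in M:\ \theta\mapsto V(\theta,\varphi(\theta))\text{ is Borel measurable}\}$. The spaces need not be metrizable. A Borel probability measure is called regular if Borel sets are approximated in measure from inside by compact sets. Integrals of measurable functions bounded above and infima are taken with values in $[-\infty,\infty)$. *)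

theory Defs
  imports "HOL-Probability.Probability_Measure"
begin

definition usc :: "('a::topological_space \<Rightarrow> real) \<Rightarrow> bool" where
  "usc f \<longleftrightarrow> (\<forall>r. open {x. f x < r})"

text \<open>The integral is the difference of the integrals of positive and negative part. It is the
  intended one for measurable functions bounded above on a probability space: the first part is
  then finite, so the value lies in \<open>[-\<infinity>, \<infinity>)\<close>.\<close>

definition eintegral :: "'a measure \<Rightarrow> ('a \<Rightarrow> real) \<Rightarrow> ereal" where
  "eintegral M f =
     enn2ereal (\<integral>\<^sup>+ x. ennreal (f x) \<partial>M) - enn2ereal (\<integral>\<^sup>+ x. ennreal (- f x) \<partial>M)"

definition regular_borel_prob :: "'a::topological_space measure \<Rightarrow> bool" where
  "regular_borel_prob \<kappa> \<longleftrightarrow> prob_space \<kappa> \<and> sets \<kappa> = sets borel \<and>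
     (\<forall>B\<in>sets borel. emeasure \<kappa> B = (SUP K\<in>{K. compact K \<and> K \<subseteq> B}. emeasure \<kappa> K))"

definition menus :: "'c::topological_space set set" where
  "menus = {D. closed D \<and> D \<noteq> {}}"

text \<open>The suprema below are real-valued. For \<open>U\<close> continuous, \<open>V\<close> upper semicontinuous and menus of
  a compact space they are taken over non-empty sets that are bounded above (in fact attained).\<close>

definition U_star :: "('t \<Rightarrow> 'c \<Rightarrow> real) \<Rightarrow> 't \<Rightarrow> 'c set \<Rightarrow> real" where
  "U_star U \<theta> D = (SUP d\<in>D. U \<theta> d)"

definition Phi :: "('t \<Rightarrow> 'c \<Rightarrow> real) \<Rightarrow> 't \<Rightarrow> 'c set \<Rightarrow> 'c set" where
  "Phi U \<theta> D = {d. is_arg_max (U \<theta>) (\<lambda>d. d \<in> D) d}"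

definition V_star ::
  "('t \<Rightarrow> 'c \<Rightarrow> real) \<Rightarrow> ('t \<Rightarrow> 'c \<Rightarrow> real) \<Rightarrow> 't \<Rightarrow> 'c set \<Rightarrow> real" where
  "V_star U V \<theta> D = (SUP d\<in>Phi U \<theta> D. V \<theta> d)"

definition ir_menus ::
  "('t \<Rightarrow> 'c::topological_space \<Rightarrow> real) \<Rightarrow> ('t \<Rightarrow> real) \<Rightarrow> 'c set set" where
  "ir_menus U u = {D \<in> menus. \<forall>\<theta>. U_star U \<theta> D \<ge> u \<theta>}"

definition mechanisms :: "('t \<Rightarrow> 'c \<Rightarrow> real) \<Rightarrow> ('t \<Rightarrow> real) \<Rightarrow> ('t \<Rightarrow> 'c) set" where
  "mechanisms U u = {\<phi>. (\<forall>\<theta>. U \<theta> (\<phi> \<theta>) \<ge> u \<theta>) \<and>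
                        (\<forall>\<theta> \<theta>'. U \<theta> (\<phi> \<theta>) \<ge> U \<theta> (\<phi> \<theta>'))}"

definition measurable_mechanisms ::
  "('t::topological_space \<Rightarrow> 'c \<Rightarrow> real) \<Rightarrow> ('t \<Rightarrow> 'c \<Rightarrow> real) \<Rightarrow> ('t \<Rightarrow> real) \<Rightarrow> ('t \<Rightarrow> 'c) set" where
  "measurable_mechanisms U V u =
     {\<phi> \<in> mechanisms U u. (\<lambda>\<theta>. V \<theta> (\<phi> \<theta>)) \<in> borel_measurable borel}"

end

(* Incentive compatibility and continuity of U make phi(theta) an element of Phi(theta, D) for D the
   closure of the range of phi, so this menu is at least as good for the principal as phi. Conversely, a
   mechanism selecting from a menu D a maximiser of V(theta, .) on Phi(theta, D) has the same value
   as D, and it belongs to the measurable mechanisms because V_star is upper semicontinuous in theta. *)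
theory Submission
  imports Defs
begin

lemma usc_compose_continuous:
  assumes "usc f" "continuous_on UNIV g"
  shows "usc (\<lambda>x. f (g x))"
  using assms open_vimage[of "{x. f x < r}" g for r] by (auto simp: usc_def vimage_def)

text \<open>If no point of \<open>K\<close> were maximal, the open sets where \<open>f\<close> lies
  strictly below some value \<open>f y\<close> would cover \<open>K\<close>. Among the finitely many
  \<open>y\<close> of a subcover, one with the largest value lies in none of these sets.\<close>

lemma usc_attains_sup:
  fixes f :: "'a::topological_space \<Rightarrow> real"
  assumes "compact K" "K \<noteq> {}" "usc f"
  shows "\<exists>x\<in>K. \<forall>y\<in>K. f y \<le> f x"
proof (rule ccontr)
  assume "\<not> ?thesis"
  then have "K \<subseteq> (\<Union>y\<in>K. {x. f x < f y})"
    by (simp add: subset_iff not_le)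
  moreover have "open {x. f x < f y}" for y
    using \<open>usc f\<close> by (simp add: usc_def)
  ultimately obtain Y where Y: "Y \<subseteq> K" "finite Y" "K \<subseteq> (\<Union>y\<in>Y. {x. f x < f y})"
    by (metis (lifting) compactE_image[OF \<open>compact K\<close>])
  have "Y \<noteq> {}"
    using Y \<open>K \<noteq> {}\<close> by auto
  then have "Max (f ` Y) \<in> f ` Y" "\<forall>z\<in>Y. f z \<le> Max (f ` Y)"
    using \<open>finite Y\<close> by (auto intro: Max_in)
  then obtain y where "y \<in> Y" "\<forall>z\<in>Y. f z \<le> f y"
    by auto
  moreover have "y \<in> (\<Union>y\<in>Y. {x. f x < f y})"
    using Y \<open>y \<in> Y\<close> by blast
  ultimately show False
    by (auto simp: not_le[symmetric])
qed

lemma usc_borel_measurable: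
  assumes "usc f"
  shows "f \<in> borel_measurable borel"
  using assms by (simp add: usc_def borel_measurable_iff_less)

text \<open>Passing from \<open>f\<close> to \<open>g\<close> raises the positive part and lowers
  the negative part. Both \<open>nn_integral\<close> and subtraction on \<open>ereal\<close> respect
  this even at infinite values.\<close>

lemma eintegral_mono:
  assumes "\<And>x. f x \<le> g x"
  shows "eintegral M f \<le> eintegral M g"
proof -
  have "(\<integral>\<^sup>+ x. ennreal (f x) \<partial>M) \<le> (\<integral>\<^sup>+ x. ennreal (g x) \<partial>M)"
    "(\<integral>\<^sup>+ x. ennreal (- g x) \<partial>M) \<le> (\<integral>\<^sup>+ x. ennreal (- f x) \<partial>M)"
    by (intro nn_integral_mono ennreal_leI; simp add: assms)+
  then show ?thesis
    unfolding eintegral_def by (intro ereal_minus_mono) (simp_all add: less_eq_ennreal.rep_eq)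
qed

locale menu_utilities =
  fixes U V :: "'t::t2_space \<Rightarrow> 'c::t2_space \<Rightarrow> real"
  assumes compact_UNIV: "compact (UNIV :: 'c set)"
    and U_continuous: "continuous_on UNIV (\<lambda>(\<theta>, c). U \<theta> c)"
    and V_usc: "usc (\<lambda>(\<theta>, c). V \<theta> c)"
begin

lemma U_section: "continuous_on S (U \<theta>)"
proof -
  have "continuous_on S (\<lambda>c. (\<theta>, c))"
    by (intro continuous_intros)
  from continuous_on_compose2[OF U_continuous this] show ?thesis
    by simp
qed

lemma V_section: "usc (V \<theta>)"
proof -
  have "continuous_on UNIV (\<lambda>c. (\<theta>, c))"
    by (intro continuous_intros)
  from usc_compose_continuous[OF V_usc this] show ?thesis
    by simp
qed

lemma menu_compact: "D \<in> menus \<Longrightarrow> compact (D :: 'c set)"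
  using compact_Int_closed[OF compact_UNIV, of D] by (simp add: menus_def)

lemma Phi_iff: "d \<in> Phi U \<theta> D \<longleftrightarrow> d \<in> D \<and> (\<forall>e\<in>D. U \<theta> e \<le> U \<theta> d)"
  by (auto simp: Phi_def is_arg_max_def not_less)

lemma Phi_nonempty:
  assumes "D \<in> menus"
  shows "Phi U \<theta> D \<noteq> {}"
proof -
  obtain d where "d \<in> D" "\<forall>e\<in>D. U \<theta> e \<le> U \<theta> d"
    using continuous_attains_sup[OF menu_compact[OF assms] _ U_section] assms
    unfolding menus_def by blast
  then have "d \<in> Phi U \<theta> D"
    unfolding Phi_iff by blast
  then show ?thesis
    by blast
qed

text \<open>Inside the compact \<open>D\<close> the maximisers are cut out by closed superlevel sets
  of the continuous \<open>U \<theta>\<close>. Compactness then lets the upper semicontinuous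
  \<open>V \<theta>\<close> attain its maximum among them.\<close>

lemma Phi_compact:
  assumes "D \<in> menus"
  shows "compact (Phi U \<theta> D)"
proof -
  have "Phi U \<theta> D = D \<inter> (\<Inter>e\<in>D. {d. U \<theta> e \<le> U \<theta> d})"
    by (auto simp: Phi_iff)
  moreover have "closed {d. U \<theta> e \<le> U \<theta> d}" for e
    by (intro closed_Collect_le continuous_on_const U_section)
  ultimately show ?thesis
    using menu_compact[OF assms] by (simp add: compact_Int_closed closed_INT)
qed

lemma U_star_eq: "d \<in> Phi U \<theta> D \<Longrightarrow> U_star U \<theta> D = U \<theta> d"
  unfolding U_star_def Phi_iff by (intro cSup_eq_maximum) auto

lemma V_le_V_star:
  assumes "D \<in> menus" "d \<in> Phi U \<theta> D"
  shows "V \<theta> d \<le> V_star U V \<theta> D"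
proof -
  obtain d' where "\<forall>e\<in>Phi U \<theta> D. V \<theta> e \<le> V \<theta> d'"
    using usc_attains_sup[OF Phi_compact Phi_nonempty V_section, OF assms(1) assms(1)] by blast
  \<comment> \<open>A real-valued supremum dominates the values only if they are bounded above; the
    attained maximum supplies the bound.\<close>
  then have "bdd_above (V \<theta> ` Phi U \<theta> D)"
    by (intro bdd_aboveI2) auto
  with assms(2) show ?thesis
    unfolding V_star_def by (rule cSUP_upper)
qed

lemma V_star_attained:
  assumes "D \<in> menus"
  shows "\<exists>d\<in>Phi U \<theta> D. V \<theta> d = V_star U V \<theta> D"
proof -
  obtain d where d: "d \<in> Phi U \<theta> D" "\<forall>e\<in>Phi U \<theta> D. V \<theta> e \<le> V \<theta> d"
    using usc_attains_sup[OF Phi_compact Phi_nonempty V_section, OF assms assms] by blast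
  then have "V_star U V \<theta> D = V \<theta> d"
    unfolding V_star_def by (intro cSup_eq_maximum) auto
  with d show ?thesis
    by metis
qed

text \<open>One half of a maximum theorem, proved without sequences or a metric. The condition
  \<open>V_star U V \<theta> D < r\<close> says that the whole slice over \<theta> lies in an open
  set of pairs, and since \<open>D\<close> is compact the tube lemma extends this to a neighbourhood
  of \<theta>.\<close>

lemma V_star_usc:
  assumes "D \<in> menus"
  shows "usc (\<lambda>\<theta>. V_star U V \<theta> D)"
  unfolding usc_def
proof
  fix r
  \<comment> \<open>The harmless pairs: \<open>d\<close> either gives the principal less than
    \<open>r\<close> or is rejected by the agent in favour of some \<open>e\<close>. With
    \<open>e\<close> fixed in each member of the union, rejection is a strict inequality between
    continuous functions, hence open.\<close>
  define G where "G = {(\<theta>, d). V \<theta> d < r} \<union> (\<Union>e\<in>D. {(\<theta>, d). U \<theta> d < U \<theta> e})"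
  have "open {x. (case x of (\<theta>, d) \<Rightarrow> V \<theta> d) < r}"
    using V_usc by (simp add: usc_def)
  moreover have "{x. (case x of (\<theta>, d) \<Rightarrow> V \<theta> d) < r} = {(\<theta>, d). V \<theta> d < r}"
    by auto
  moreover have "open {(\<theta>, d). U \<theta> d < U \<theta> e}" for e
  proof -
    have "continuous_on UNIV (\<lambda>x :: 't \<times> 'c. (fst x, e))"
      by (intro continuous_intros)
    from continuous_on_compose2[OF U_continuous this]
    have "continuous_on UNIV (\<lambda>x :: 't \<times> 'c. U (fst x) e)"
      by simp
    with U_continuous show ?thesis
      by (simp add: case_prod_unfold open_Collect_less)
  qed
  ultimately have "open G"
    unfolding G_def by (intro open_Un open_UN ballI) simp_all
  have iff: "V_star U V \<theta> D < r \<longleftrightarrow> {\<theta>} \<times> D \<subseteq> G" for \<theta>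
  proof
    assume r: "V_star U V \<theta> D < r"
    have "(\<theta>, d) \<in> G" if d: "d \<in> D" for d
    proof (cases "d \<in> Phi U \<theta> D")
      case True
      from V_le_V_star[OF assms this] r have "V \<theta> d < r"
        by (rule le_less_trans)
      then show ?thesis
        by (simp add: G_def)
    next
      case False
      then obtain e where "e \<in> D" "U \<theta> d < U \<theta> e"
        using d by (auto simp: Phi_iff not_le)
      then show ?thesis
        by (auto simp: G_def)
    qed
    then show "{\<theta>} \<times> D \<subseteq> G"
      by blast
  next
    assume G: "{\<theta>} \<times> D \<subseteq> G"
    \<comment> \<open>Attainment keeps the inequality strict. As \<open>d\<close> is optimal for the
      agent, no \<open>e\<close> beats it, so \<open>d\<close> can be in \<open>G\<close> only
      through \<open>V \<theta> d < r\<close>.\<close>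
    obtain d where "d \<in> Phi U \<theta> D" "V \<theta> d = V_star U V \<theta> D"
      using V_star_attained[OF assms] by blast
    moreover from this have "(\<theta>, d) \<in> G"
      using G by (auto simp: Phi_iff)
    ultimately show "V_star U V \<theta> D < r"
      by (force simp: G_def Phi_iff)
  qed
  show "open {\<theta>. V_star U V \<theta> D < r}"
  proof (subst open_subopen, safe)
    fix \<theta> assume "V_star U V \<theta> D < r"
    then have "{\<theta>} \<times> D \<subseteq> G"
      by (simp only: iff)
    then obtain N where N: "open N" "\<theta> \<in> N" "N \<times> D \<subseteq> G"
      using Elementary_Topology.tube_lemma[OF menu_compact[OF assms] \<open>open G\<close>] by blast
    then have "N \<subseteq> {\<theta>. V_star U V \<theta> D < r}"
      unfolding iff by blast
    with N show "\<exists>T. open T \<and> \<theta> \<in> T \<and> T \<subseteq> {\<theta>. V_star U V \<theta> D < r}"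
      by blast
  qed
qed

text \<open>The functions of \<theta> agree everywhere, so one mechanism reproduces the value of the
  menu under all measures at once.\<close>

lemma mechanism_of_menu:
  assumes "D \<in> ir_menus U u"
  shows "\<exists>\<phi>\<in>measurable_mechanisms U V u. (\<lambda>\<theta>. V \<theta> (\<phi> \<theta>)) = (\<lambda>\<theta>. V_star U V \<theta> D)"
proof -
  have D: "D \<in> menus" and ir: "\<And>\<theta>. u \<theta> \<le> U_star U \<theta> D"
    using assms by (auto simp: ir_menus_def)
  obtain \<phi> where \<phi>: "\<And>\<theta>. \<phi> \<theta> \<in> Phi U \<theta> D" "\<And>\<theta>. V \<theta> (\<phi> \<theta>) = V_star U V \<theta> D"
    using V_star_attained[OF D] by metis
  moreover have "\<phi> \<in> mechanisms U u"
    \<comment> \<open>Every \<open>\<phi> \<theta>'\<close> is itself an element of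
      \<open>D\<close>, so optimality of \<open>\<phi> \<theta>\<close> in \<open>D\<close> includes
      incentive compatibility.\<close>
    using \<phi>(1) ir U_star_eq[OF \<phi>(1)] by (simp add: mechanisms_def Phi_iff)
  moreover have "(\<lambda>\<theta>. V \<theta> (\<phi> \<theta>)) \<in> borel_measurable borel"
    using usc_borel_measurable[OF V_star_usc[OF D]] by (simp add: \<phi>(2))
  ultimately show ?thesis
    by (intro bexI[of _ \<phi>]) (simp_all add: measurable_mechanisms_def)
qed

lemma menu_of_mechanism:
  assumes "\<phi> \<in> mechanisms U u"
  shows "\<exists>D\<in>ir_menus U u. \<forall>\<theta>. V \<theta> (\<phi> \<theta>) \<le> V_star U V \<theta> D"
proof -
  define D where "D = closure (range \<phi>)"
  have D: "D \<in> menus"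
    by (simp add: D_def menus_def)
  \<comment> \<open>Incentive compatibility puts the range of \<phi> into a closed set, so the limit
    points added by the closure do not tempt any type either.\<close>
  have "D \<subseteq> {d. U \<theta> d \<le> U \<theta> (\<phi> \<theta>)}" for \<theta>
    unfolding D_def using assms
    by (intro closure_minimal closed_Collect_le continuous_on_const U_section)
       (auto simp: mechanisms_def)
  moreover have "\<phi> \<theta> \<in> D" for \<theta>
    unfolding D_def by (meson closure_subset rangeI subsetD)
  ultimately have \<phi>: "\<phi> \<theta> \<in> Phi U \<theta> D" for \<theta>
    by (auto simp: Phi_iff)
  then have "D \<in> ir_menus U u"
    using assms D by (simp add: ir_menus_def mechanisms_def U_star_eq[OF \<phi>])
  with V_le_V_star[OF D \<phi>] show ?thesis
    by blast
qed

end

theorem mainTheorem3: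
  fixes U V :: "'t::t2_space \<Rightarrow> 'c::t2_space \<Rightarrow> real"
    and u :: "'t \<Rightarrow> real"
    and \<K> :: "'t measure set"
    and \<alpha> :: "'t measure \<Rightarrow> real"
  assumes "compact (UNIV :: 'c set)"
    and "continuous_on UNIV (\<lambda>(\<theta>, c). U \<theta> c)"
    and "usc (\<lambda>(\<theta>, c). V \<theta> c)"
    and "compact (UNIV :: 't set) \<or> bounded (range (\<lambda>(\<theta>, c). V \<theta> c))"
    and "\<exists>c. \<forall>\<theta>. U \<theta> c \<ge> u \<theta>"
    and "\<K> \<noteq> {}"
    and "\<forall>\<kappa>\<in>\<K>. regular_borel_prob \<kappa>"
  shows "(SUP D\<in>ir_menus U u. INF \<kappa>\<in>\<K>. eintegral \<kappa> (\<lambda>\<theta>. V_star U V \<theta> D) + ereal (\<alpha> \<kappa>)) =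
         (SUP \<phi>\<in>measurable_mechanisms U V u.
            INF \<kappa>\<in>\<K>. eintegral \<kappa> (\<lambda>\<theta>. V \<theta> (\<phi> \<theta>)) + ereal (\<alpha> \<kappa>))"
proof -
  interpret menu_utilities U V
    using assms by unfold_locales
  show ?thesis
  proof (rule antisym)
    show "(SUP D\<in>ir_menus U u. INF \<kappa>\<in>\<K>. eintegral \<kappa> (\<lambda>\<theta>. V_star U V \<theta> D) + ereal (\<alpha> \<kappa>)) \<le>
      (SUP \<phi>\<in>measurable_mechanisms U V u.
         INF \<kappa>\<in>\<K>. eintegral \<kappa> (\<lambda>\<theta>. V \<theta> (\<phi> \<theta>)) + ereal (\<alpha> \<kappa>))"
    proof (rule SUP_mono)
      fix D assume "D \<in> ir_menus U u"
      then obtain \<phi> where "\<phi> \<in> measurable_mechanisms U V u"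
        and "(\<lambda>\<theta>. V \<theta> (\<phi> \<theta>)) = (\<lambda>\<theta>. V_star U V \<theta> D)"
        using mechanism_of_menu by blast
      then show "\<exists>\<phi>\<in>measurable_mechanisms U V u.
          (INF \<kappa>\<in>\<K>. eintegral \<kappa> (\<lambda>\<theta>. V_star U V \<theta> D) + ereal (\<alpha> \<kappa>)) \<le>
          (INF \<kappa>\<in>\<K>. eintegral \<kappa> (\<lambda>\<theta>. V \<theta> (\<phi> \<theta>)) + ereal (\<alpha> \<kappa>))"
        by (intro bexI[of _ \<phi>]) auto
    qed
  next
    show "(SUP \<phi>\<in>measurable_mechanisms U V u.
         INF \<kappa>\<in>\<K>. eintegral \<kappa> (\<lambda>\<theta>. V \<theta> (\<phi> \<theta>)) + ereal (\<alpha> \<kappa>)) \<le>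
      (SUP D\<in>ir_menus U u. INF \<kappa>\<in>\<K>. eintegral \<kappa> (\<lambda>\<theta>. V_star U V \<theta> D) + ereal (\<alpha> \<kappa>))"
    proof (rule SUP_mono)
      fix \<phi> assume "\<phi> \<in> measurable_mechanisms U V u"
      then have "\<phi> \<in> mechanisms U u"
        by (simp add: measurable_mechanisms_def)
      then obtain D where "D \<in> ir_menus U u" "\<forall>\<theta>. V \<theta> (\<phi> \<theta>) \<le> V_star U V \<theta> D"
        using menu_of_mechanism by blast
      then show "\<exists>D\<in>ir_menus U u.
          (INF \<kappa>\<in>\<K>. eintegral \<kappa> (\<lambda>\<theta>. V \<theta> (\<phi> \<theta>)) + ereal (\<alpha> \<kappa>)) \<le>
          (INF \<kappa>\<in>\<K>. eintegral \<kappa> (\<lambda>\<theta>. V_star U V \<theta> D) + ereal (\<alpha> \<kappa>))"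
        \<comment> \<open>The menu is chosen before the measure and dominates \<phi> at every
          \<theta>, so the inequality holds for each \<kappa> separately and survives the
          infimum.\<close>
        by (intro bexI[of _ D] INF_superset_mono add_right_mono eintegral_mono) auto
    qed
  qed
qed

end
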